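(* Let $(x_j,k_j)_{j\geq0}$ be either of the two sequences obtained by iterating the map $(x,k)\mapsto(3x+4k,\,2x+3k)$ starting from $(x_0,k_0)=(1,2)$ or from $(x_0,k_0)=(5,4)$, and set $m_j=(x_j-1)/2$ and $a_j=m_j(m_j+1)$. Then, for every $j$ with $m_j\geq1$, the generalized sun graph $$\mathcal{S}_6(a_j)=C_{6,1}(0,a_j,a_j,2a_j,a_j,a_j)$$ is an integral unicyclic graph on $6a_j+6$ vertices whose unique cycle has length six, with spectrum $$\Bigl\{0^{[6a_j-4]},\ \pm m_j^{[2]},\ \pm(m_j+1)^{[2]},\ \pm k_j\Bigr\}.$$ In particular, the assertion "if a generalized sun graph that is not a cycle is integral, then the order of its cycle is a multiple of $4$" fails for infinitely many graphs.
   Context: A graph is integral if all eigenvalues of its adjacency matrix are integers; its spectrum is that of its adjacency matrix, and $x^{[r]}$ means that the eigenvalue $x$ is listed with multiplicity $r$ (so $\pm x^{[r]}$ means that each of $x$ and $-x$ is listed with multiplicity $r$; no superscript means multiplicity $1$). A connected graph with exactly one cycle is unicyclic. $P_t$ denotes the path on $t$ vertices; attaching $P_t$ to a vertex $v$ means adding $t$ new vertices $u_1,\dots,u_t$ with the edges $vu_1$ and $u_iu_{i+1}$, $1\leq i\leq t-1$. A generalized sun graph is a graph obtained from a cycle by attaching paths to vertices of the cycle. For nonnegative integers $n_1,\dots,n_b$, $C_{b,1}(n_1,\dots,n_b)$ is the graph obtained from the cycle $C_b=v_1v_2\cdots v_bv_1$ by attaching $n_k$ pendant vertices (copies of $P_1$)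 to $v_k$ for $1\leq k\leq b$. *)

theory Defs
  imports
    Complex_Main
    "HOL-Library.Multiset"
    "HOL-Computational_Algebra.Polynomial"
    "Graph_Theory.Graph_Theory"
    "Jordan_Normal_Form.Char_Poly"
begin

text \<open>
  Undirected simple graphs are symmetric loop-free digraphs (\<^locale>\<open>pair_graph\<close>): an edge
  is a pair of opposite arcs.  The cycle predicate of the Graph_Theory library also
  accepts the closed walk u, v, u, which is not a cycle of an undirected graph; hence
  cycles are introduced below as subgraphs.
\<close>

definition undirected :: "'a set \<Rightarrow> ('a \<times> 'a) set \<Rightarrow> 'a pair_pre_digraph" where
  "undirected V E = \<lparr> pverts = V, parcs = E \<union> E\<inverse> \<rparr>"

definition cycle_graph :: "'a list \<Rightarrow> 'a pair_pre_digraph" where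
  "cycle_graph vs = undirected (set vs)
     {(vs ! i, vs ! ((i + 1) mod length vs)) | i. i < length vs}"

definition is_cycle_graph :: "'a pair_pre_digraph \<Rightarrow> bool" where
  "is_cycle_graph C \<longleftrightarrow> (\<exists>vs. distinct vs \<and> 3 \<le> length vs \<and> C = cycle_graph vs)"

definition cycle_in :: "'a pair_pre_digraph \<Rightarrow> 'a pair_pre_digraph \<Rightarrow> bool" where
  "cycle_in C G \<longleftrightarrow> is_cycle_graph C \<and> subgraph (with_proj C) (with_proj G)"

definition unicyclic :: "'a pair_pre_digraph \<Rightarrow> bool" where
  "unicyclic G \<longleftrightarrow>
     pair_graph G \<and> Digraph_Component.connected (with_proj G) \<and> (\<exists>!C. cycle_in C G)"

text \<open>The edges are $v u_1$ and $u_i u_{i+1}$, where $us = [u_1, \dots, u_t]$.\<close>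

definition attach_path ::
    "'a \<Rightarrow> 'a list \<Rightarrow> 'a pair_pre_digraph \<Rightarrow> 'a pair_pre_digraph" where
  "attach_path v us G =
     undirected (pverts G \<union> set us) (parcs G \<union> set (zip (v # us) us))"

text \<open>
  Several paths may be attached to the same vertex of the cycle; attaching none is
  allowed, so that cycles are themselves generalized sun graphs.
\<close>

inductive sun_over :: "'a pair_pre_digraph \<Rightarrow> 'a pair_pre_digraph \<Rightarrow> bool" for C where
  base: "is_cycle_graph C \<Longrightarrow> sun_over C C"
| attach: "\<lbrakk> sun_over C G; v \<in> pverts C; us \<noteq> []; distinct us; set us \<inter> pverts G = {} \<rbrakk>
    \<Longrightarrow> sun_over C (attach_path v us G)"

definition generalized_sun :: "'a pair_pre_digraph \<Rightarrow> bool" where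
  "generalized_sun G \<longleftrightarrow> (\<exists>C. sun_over C G)"

text \<open>
  $C_{b,1}(n_1, \dots, n_b)$ for $b$ the length of the list.  The vertex $(k, 0)$ is the cycle
  vertex $v_{k+1}$, and $(k, i)$ with $1 \le i \le n_{k+1}$ are its pendant vertices.
\<close>

definition pendant_cycle :: "nat list \<Rightarrow> (nat \<times> nat) pair_pre_digraph" where
  "pendant_cycle ns = undirected
     {(k, i) | k i. k < length ns \<and> i \<le> ns ! k}
     ({((k, 0), ((k + 1) mod length ns, 0)) | k. k < length ns} \<union>
      {((k, 0), (k, i)) | k i. k < length ns \<and> 1 \<le> i \<and> i \<le> ns ! k})"

definition S6 :: "nat \<Rightarrow> (nat \<times> nat) pair_pre_digraph" where
  "S6 a = pendant_cycle [0, a, a, 2 * a, a, a]"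

text \<open>
  The adjacency matrix is taken over the complex numbers, so that no eigenvalue is left
  out by definition.  The enumeration of the vertices is an arbitrary one; another choice
  gives a permutation-similar matrix, hence the same eigenvalues and multiplicities.
\<close>

definition adjacency_matrix :: "'a pair_pre_digraph \<Rightarrow> complex mat" where
  "adjacency_matrix G =
     (let vs = (SOME vs. distinct vs \<and> set vs = pverts G)
      in mat (length vs) (length vs)
           (\<lambda>(i, j). if (vs ! i, vs ! j) \<in> parcs G then 1 else 0))"

definition graph_spectrum :: "'a pair_pre_digraph \<Rightarrow> complex multiset" where
  "graph_spectrum G = proots (char_poly (adjacency_matrix G))"

definition integral_graph :: "'a pair_pre_digraph \<Rightarrow> bool" where
  "integral_graph G \<longleftrightarrow> (\<forall>z. eigenvalue (adjacency_matrix G) z \<longrightarrow> z \<in> \<int>)"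

definition cycle_order_assertion :: "'a pair_pre_digraph \<Rightarrow> bool" where
  "cycle_order_assertion G \<longleftrightarrow>
     (generalized_sun G \<and> \<not> is_cycle_graph G \<and> integral_graph G \<longrightarrow>
       (\<forall>C. cycle_in C G \<longrightarrow> 4 dvd card (pverts C)))"

definition xk_step :: "nat \<times> nat \<Rightarrow> nat \<times> nat" where
  "xk_step = (\<lambda>(x, k). (3 * x + 4 * k, 2 * x + 3 * k))"

definition x_seq :: "nat \<times> nat \<Rightarrow> nat \<Rightarrow> nat" where
  "x_seq s j = fst ((xk_step ^^ j) s)"

definition k_seq :: "nat \<times> nat \<Rightarrow> nat \<Rightarrow> nat" where
  "k_seq s j = snd ((xk_step ^^ j) s)"

definition m_seq :: "nat \<times> nat \<Rightarrow> nat \<Rightarrow> nat" where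
  "m_seq s j = (x_seq s j - 1) div 2"

definition a_seq :: "nat \<times> nat \<Rightarrow> nat \<Rightarrow> nat" where
  "a_seq s j = m_seq s j * (m_seq s j + 1)"

text \<open>Neither the subtraction nor the division in the definition of \<^const>\<open>m_seq\<close> truncates.\<close>

lemma m_seq_exact:
  assumes "s \<in> {(1, 2), (5, 4)}"
  shows "real (m_seq s j) = (real (x_seq s j) - 1) / 2"
proof -
  have "odd (x_seq s j)"
    using assms by (induction j) (auto simp: x_seq_def xk_step_def split: prod.splits)
  then show ?thesis
    by (auto simp: m_seq_def elim!: oddE)
qed

end

theory Submission
  imports Defs
begin

text \<open>
  Order the vertices with the cycle $C_b$ first.  The pendant block of $xI - A$ is $xI$, so eliminating
  it (Schur complement) gives $x^b \chi(x) = x^{\sum n_k} \det (x^2 I - x A(C_b) - \mathrm{diag}(n_k))$.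
  For $\mathcal{S}_6(a)$ with $a = m(m+1)$ the $6 \times 6$ determinant splits along the reflection through
  the two opposite vertices without and with $2a$ pendants; both parts contain the factor
  $(x^2-a)^2 - x^2 = (x^2-m^2)(x^2-(m+1)^2)$, and what remains is $x^2(x^2-(2a+4))$.  Thus
  the spectrum is integral iff $2a+4$ is a square $k^2$, i.e. iff $(2m+1)^2 - 2k^2 = -7$; the map
  $(x,k) \mapsto (3x+4k, 2x+3k)$ preserves the form $x^2 - 2k^2$, whose value is $-7$ at both starting points.
\<close>

section \<open>Cycles with pendant vertices\<close>

lemma parcs_pendant_cycle:
  "((k, i), (l, j)) \<in> parcs (pendant_cycle ns) \<longleftrightarrow> k < length ns \<and> l < length ns \<and>
     (i = 0 \<and> j = 0 \<and> (l = Suc k mod length ns \<or> k = Suc l mod length ns) \<or>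
      k = l \<and> (i = 0 \<and> 1 \<le> j \<and> j \<le> ns ! k \<or> j = 0 \<and> 1 \<le> i \<and> i \<le> ns ! k))"
  by (cases "ns = []") (auto simp: pendant_cycle_def undirected_def)

lemma pverts_pendant_cycle:
  "pverts (pendant_cycle ns) = {(k, i). k < length ns \<and> i \<le> ns ! k}"
  by (auto simp: pendant_cycle_def undirected_def)

lemma pverts_pendant_cycle_Sigma:
  "pverts (pendant_cycle ns) = Sigma {..<length ns} (\<lambda>k. {..ns ! k})"
  by (auto simp: pverts_pendant_cycle)

lemma finite_pverts_pendant_cycle [simp]: "finite (pverts (pendant_cycle ns))"
  by (auto simp: pverts_pendant_cycle_Sigma)

lemma card_pverts_pendant_cycle: "card (pverts (pendant_cycle ns)) = sum_list ns + length ns"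
  by (simp add: pverts_pendant_cycle_Sigma sum_Suc sum_list_sum_nth atLeast0LessThan)

text \<open>For length 1 the successor modulo the length would give a loop at the cycle vertex; from
  length 2 on, the successor is a different index, and pendant arcs join different second
  components.\<close>

lemma pair_graph_pendant_cycle:
  assumes "2 \<le> length ns"
  shows "pair_graph (pendant_cycle ns)"
proof -
  have no_loop: "k \<noteq> Suc k mod length ns" if "k < length ns" for k
    using assms that by (cases "Suc k = length ns") auto
  have sub: "parcs (pendant_cycle ns) \<subseteq> pverts (pendant_cycle ns) \<times> pverts (pendant_cycle ns)"
    by (auto simp: parcs_pendant_cycle pverts_pendant_cycle)
  have irr: "fst e \<noteq> snd e" if "e \<in> parcs (pendant_cycle ns)" for e
    using that no_loop by (cases e) (auto simp: parcs_pendant_cycle)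
  show ?thesis
  proof
    show "symmetric (with_proj (pendant_cycle ns))"
      by (auto simp: symmetric_def intro!: symI) (auto simp: parcs_pendant_cycle)
    show "finite (parcs (pendant_cycle ns))"
      using sub by (rule finite_subset) simp
  qed (use sub irr in \<open>auto\<close>)
qed

lemma connected_pendant_cycle:
  assumes "2 \<le> length ns"
  shows "Digraph_Component.connected (with_proj (pendant_cycle ns))"
proof -
  define G where "G = pendant_cycle ns"
  interpret pair_graph G
    unfolding G_def by (rule pair_graph_pendant_cycle[OF assms])
  have cyc: "(0, 0) \<rightarrow>\<^sup>*\<^bsub>with_proj G\<^esub> (k, 0)" if "k < length ns" for k
    using that
  proof (induction k)
    case 0
    then show ?case
      by (intro reachable_refl) (auto simp: G_def pverts_pendant_cycle)
  next
    case (Suc k)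
    then have "((k, 0), (Suc k, 0)) \<in> parcs G"
      by (auto simp: G_def parcs_pendant_cycle)
    with Suc show ?case
      by (auto intro: reachable_adj_trans)
  qed
  have root: "(0, 0) \<rightarrow>\<^sup>*\<^bsub>with_proj G\<^esub> v" if v_in: "v \<in> pverts G" for v
  proof -
    obtain k i where v: "v = (k, i)" "k < length ns" "i \<le> ns ! k"
      using v_in by (auto simp: G_def pverts_pendant_cycle)
    then have "i = 0 \<or> ((k, 0), (k, i)) \<in> parcs G"
      by (auto simp: G_def parcs_pendant_cycle)
    with cyc[OF v(2)] v(1) show ?thesis
      by (auto intro: reachable_adj_trans)
  qed
  \<comment> \<open>\<open>connected\<close> asks for strong connectedness of the symmetric closure.
    Since the arcs are symmetric already, a walk from \<open>u\<close> back to \<open>(0, 0)\<close>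
    and on to \<open>v\<close> exists in \<open>G\<close> itself.\<close>
  have "u \<rightarrow>\<^sup>*\<^bsub>with_proj (mk_symmetric (with_proj G))\<^esub> v" if "u \<in> pverts G" "v \<in> pverts G" for u v
    using root[OF that(1)] root[OF that(2)]
    by (intro reachable_mk_symmetricI) (blast intro: reachable_trans symmetric_reachable')
  moreover have "(0, 0) \<in> pverts G"
    using assms by (auto simp: G_def pverts_pendant_cycle)
  ultimately show ?thesis
    unfolding connected_def G_def[symmetric] by (intro strongly_connectedI) auto
qed

section \<open>Existence and uniqueness of the cycle\<close>

lemma pendant_cycle_replicate_0:
  "pendant_cycle (replicate b 0) = cycle_graph (map (\<lambda>k. (k, 0)) [0..<b])"
proof -
  have "{((k, 0 :: nat), (k, i)) | k i. k < b \<and> 1 \<le> i \<and> i \<le> replicate b (0 :: nat) ! k} = {}"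
    by auto
  moreover have "{(k, i :: nat) | k i. k < b \<and> i \<le> replicate b 0 ! k} = set (map (\<lambda>k. (k, 0)) [0..<b])"
    by auto
  moreover have "{((k, 0 :: nat), ((k + 1) mod b, 0 :: nat)) | k. k < b} =
      {(map (\<lambda>k. (k, 0)) [0..<b] ! i, map (\<lambda>k. (k, 0)) [0..<b] ! ((i + 1) mod b)) | i. i < b}"
    by (intro Collect_cong ex_cong1) auto
  ultimately show ?thesis
    unfolding pendant_cycle_def cycle_graph_def
    by (simp only: length_replicate length_map length_upt diff_zero Un_empty_right)
qed

lemma is_cycle_graph_pendant_cycle_0:
  assumes "3 \<le> b"
  shows "is_cycle_graph (pendant_cycle (replicate b 0))"
  unfolding is_cycle_graph_def pendant_cycle_replicate_0
  using assms by (intro exI[of _ "map (\<lambda>k. (k, 0)) [0..<b]"]) (auto simp: distinct_map inj_on_def)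

lemma is_cycle_graph_arcs:
  assumes "is_cycle_graph C"
  shows "parcs C \<subseteq> pverts C \<times> pverts C" "sym (parcs C)" "pverts C \<noteq> {}"
proof -
  obtain vs where vs: "3 \<le> length vs" "C = cycle_graph vs"
    using assms by (auto simp: is_cycle_graph_def)
  have "(i + 1) mod length vs < length vs" for i
    using vs(1) by (intro mod_less_divisor) linarith
  then show "parcs C \<subseteq> pverts C \<times> pverts C" "sym (parcs C)" "pverts C \<noteq> {}"
    using vs by (auto simp: cycle_graph_def undirected_def sym_Un_converse)
qed

text \<open>Successor and predecessor in the cyclic order differ because there are at least three
  vertices. This is the property of cycles on which the uniqueness proof rests: it excludes pendant
  vertices.\<close>

lemma is_cycle_graph_two_neighbours:
  assumes "is_cycle_graph C" "v \<in> pverts C"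
  obtains u w where "u \<noteq> w" "(v, u) \<in> parcs C" "(v, w) \<in> parcs C"
proof -
  obtain vs where vs: "distinct vs" "3 \<le> length vs" "C = cycle_graph vs"
    using assms(1) by (auto simp: is_cycle_graph_def)
  define n where "n = length vs"
  have arc: "(vs ! i, vs ! ((i + 1) mod n)) \<in> parcs C" if "i < n" for i
    using that by (auto simp: vs(3) cycle_graph_def undirected_def n_def)
  obtain i where i: "i < n" "v = vs ! i"
    using assms(2) by (auto simp: vs(3) cycle_graph_def undirected_def n_def in_set_conv_nth)
  define s where "s = (i + 1) mod n"
  \<comment> \<open>The cyclic predecessor; index 0 is treated apart because \<open>i - 1\<close>
    truncates there.\<close>
  define r where "r = (if i = 0 then n - 1 else i - 1)"
  have n: "3 \<le> n" using vs(2) by (simp add: n_def)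
  have r: "r < n" "Suc r mod n = i"
    using i(1) n by (auto simp: r_def)
  have s: "s < n" "s = (if i = n - 1 then 0 else i + 1)"
    using i(1) n by (auto simp: s_def)
  have "s \<noteq> r"
    using s(2) i(1) n by (auto simp: r_def split: if_splits)
  then have "vs ! s \<noteq> vs ! r"
    using vs(1) r(1) s(1) by (simp add: nth_eq_iff_index_eq n_def)
  moreover have "(v, vs ! s) \<in> parcs C"
    using arc[OF i(1)] by (simp add: i(2) s_def)
  moreover have "(v, vs ! r) \<in> parcs C"
    using arc[OF r(1)] is_cycle_graph_arcs(2)[OF assms(1)] by (simp add: r(2) i(2) symD)
  ultimately show ?thesis by (rule that)
qed

lemma cycle_in_pendant_cycle:
  assumes "3 \<le> length ns"
  shows "cycle_in (pendant_cycle (replicate (length ns) 0)) (pendant_cycle ns)"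
proof -
  define C where "C = pendant_cycle (replicate (length ns) 0)"
  have "pair_graph C" "pair_graph (pendant_cycle ns)"
    unfolding C_def using assms by (auto intro!: pair_graph_pendant_cycle)
  then have "wf_digraph (with_proj C)" "wf_digraph (with_proj (pendant_cycle ns))"
    by (simp_all add: wf_digraph_wp_iff pair_graph_def pair_digraph_def pair_fin_digraph_def)
  moreover have "pverts C \<subseteq> pverts (pendant_cycle ns)"
    by (auto simp: C_def pverts_pendant_cycle)
  moreover have "parcs C \<subseteq> parcs (pendant_cycle ns)"
    by (auto simp: C_def parcs_pendant_cycle)
  ultimately show ?thesis
    using is_cycle_graph_pendant_cycle_0[OF assms]
    by (auto simp: cycle_in_def subgraph_def compatible_def C_def)
qed

text \<open>Every vertex of \<open>C\<close> has two neighbours in \<open>C\<close>, so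
  \<open>C\<close> avoids pendant vertices. A cycle vertex then has only its two cyclic neighbours
  to choose from and must use both; hence \<open>C\<close> is closed under the successor and runs
  through the whole cycle.\<close>

lemma cycle_in_pendant_cycle_unique:
  assumes "3 \<le> length ns" "cycle_in C (pendant_cycle ns)"
  shows "C = pendant_cycle (replicate (length ns) 0)"
proof -
  define b where "b = length ns"
  define G where "G = pendant_cycle ns"
  have cyc: "is_cycle_graph C" and sub: "pverts C \<subseteq> pverts G" "parcs C \<subseteq> parcs G"
    using assms(2) by (auto simp: cycle_in_def subgraph_def G_def)
  have nbrs: "\<exists>u w. u \<noteq> w \<and> (v, u) \<in> parcs C \<and> (v, w) \<in> parcs C" if "v \<in> pverts C" for v
    using is_cycle_graph_two_neighbours[OF cyc that] by metis
  have arcs: "parcs C \<subseteq> pverts C \<times> pverts C" "sym (parcs C)"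
    using is_cycle_graph_arcs[OF cyc] by auto
  have on_cycle: "i = 0 \<and> k < b" if ki: "(k, i) \<in> pverts C" for k i
  proof -
    obtain u w where uw: "u \<noteq> w" "((k, i), u) \<in> parcs G" "((k, i), w) \<in> parcs G"
      using nbrs[OF ki] sub(2) by blast
    have "k < b"
      using sub(1) ki by (auto simp: G_def pverts_pendant_cycle b_def)
    moreover have "u = (k, 0)" "w = (k, 0)" if "i \<noteq> 0"
      using uw(2,3) that by (cases u; cases w; auto simp: G_def parcs_pendant_cycle)+
    ultimately show ?thesis
      using uw(1) by auto
  qed
  have succ: "((k, 0), (Suc k mod b, 0)) \<in> parcs C" if k: "(k, 0) \<in> pverts C" for k
  proof -
    obtain u w where uw: "u \<noteq> w" "((k, 0), u) \<in> parcs C" "((k, 0), w) \<in> parcs C"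
      using nbrs[OF k] by blast
    have nbr: "\<exists>l. v = (l, 0) \<and> l < b \<and> (l = Suc k mod b \<or> k = Suc l mod b)"
      if "((k, 0), v) \<in> parcs C" for v
    proof -
      obtain l j where v: "v = (l, j)" by (cases v)
      then have "(l, j) \<in> pverts C" "((k, 0), (l, j)) \<in> parcs G"
        using that arcs(1) sub(2) by auto
      then show ?thesis
        using on_cycle[of l j] by (auto simp: v G_def parcs_pendant_cycle b_def)
    qed
    \<comment> \<open>The cyclic predecessor is unique, so two different neighbours cannot both be
      predecessors of \<open>k\<close>; one of them is its successor.\<close>
    have pred: "l = l'" if "l < b" "l' < b" "Suc l mod b = Suc l' mod b" for l l'
      using that by (auto simp: mod_Suc split: if_splits)
    show ?thesis
      using nbr[OF uw(2)] nbr[OF uw(3)] uw pred by metis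
  qed
  obtain k0 where k0: "(k0, 0) \<in> pverts C"
    using is_cycle_graph_arcs(3)[OF cyc] on_cycle by fast
  have reach: "((k0 + n) mod b, 0) \<in> pverts C" for n
  proof (induction n)
    case 0
    then show ?case using k0 on_cycle[OF k0] by simp
  next
    case (Suc n)
    have "(Suc ((k0 + n) mod b) mod b, 0) \<in> pverts C"
      using succ[OF Suc] arcs(1) by blast
    then show ?case by (simp add: mod_Suc_eq)
  qed
  have all: "(k, 0) \<in> pverts C" if "k < b" for k
    \<comment> \<open>Going from \<open>k0\<close> to \<open>k\<close> forwards takes
      \<open>k + b - k0\<close> steps modulo \<open>b\<close>; adding \<open>b\<close> first keeps
      the subtraction exact, as \<open>k0 < b\<close>.\<close>
    using reach[of "k + b - k0"] on_cycle[OF k0] that by simp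
  have verts: "pverts C = pverts (pendant_cycle (replicate b 0))"
    using on_cycle all by (auto simp: pverts_pendant_cycle)
  have "parcs C \<subseteq> parcs (pendant_cycle (replicate b 0))"
  proof clarify
    fix k i l j assume a: "((k, i), (l, j)) \<in> parcs C"
    then have "((k, i), (l, j)) \<in> parcs G" "(k, i) \<in> pverts C" "(l, j) \<in> pverts C"
      using sub(2) arcs(1) by auto
    then show "((k, i), (l, j)) \<in> parcs (pendant_cycle (replicate b 0))"
      using on_cycle[of k i] on_cycle[of l j]
      by (auto simp: G_def parcs_pendant_cycle b_def)
  qed
  moreover have "parcs (pendant_cycle (replicate b 0)) \<subseteq> parcs C"
    using succ all symD[OF arcs(2)] by (auto simp: parcs_pendant_cycle)
  ultimately show ?thesis
    using verts by (simp add: b_def)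
qed

section \<open>Generalized sun structure\<close>

lemma attach_pendant_vertex:
  assumes "k < length ns"
  shows "attach_path (k, 0) [(k, Suc (ns ! k))] (pendant_cycle ns) =
    pendant_cycle (ns[k := Suc (ns ! k)])" (is "?L = ?R")
proof -
  have "pverts ?L = pverts ?R"
    using assms by (auto simp: attach_path_def undirected_def pverts_pendant_cycle
        nth_list_update le_Suc_eq split: if_splits)
  moreover have "parcs ?L = parcs ?R"
  proof -
    \<comment> \<open>\<open>attach_path\<close> takes the symmetric closure again; this adds no arc
      to the old part, whose arcs are already symmetric.\<close>
    have "parcs ?L = parcs (pendant_cycle ns) \<union> (parcs (pendant_cycle ns))\<inverse> \<union>
        {((k, 0), (k, Suc (ns ! k))), ((k, Suc (ns ! k)), (k, 0))}"
      by (auto simp: attach_path_def undirected_def)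
    moreover have "(e \<in> \<dots>) = (e \<in> parcs ?R)" for e
      using assms by (cases e) (auto simp: parcs_pendant_cycle nth_list_update le_Suc_eq split: if_splits)
    ultimately show ?thesis by blast
  qed
  ultimately show ?thesis by simp
qed

text \<open>Induction on the number of pendant vertices: the last one at some \<open>v\<close> with
  a nonzero count is removed and attached again as a path with one vertex. With all counts zero the
  graph is the cycle itself.\<close>

lemma sun_over_pendant_cycle:
  assumes "3 \<le> length ns"
  shows "sun_over (pendant_cycle (replicate (length ns) 0)) (pendant_cycle ns)"
  using assms
proof (induction "sum_list ns" arbitrary: ns rule: less_induct)
  case less
  show ?case
  proof (cases "\<forall>n \<in> set ns. n = 0")
    case True
    then have "replicate (length ns) 0 = ns"
      by (simp add: replicate_length_same)
    then show ?thesis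
      using sun_over.base is_cycle_graph_pendant_cycle_0[OF less.prems] by metis
  next
    case False
    then obtain k n where k: "k < length ns" "ns ! k = Suc n"
      by (metis in_set_conv_nth not0_implies_Suc)
    define ms where "ms = ns[k := n]"
    have ms: "length ms = length ns" "ms ! k = n" "ns = ms[k := Suc (ms ! k)]"
      using k list_update_id[of ns k] by (auto simp: ms_def)
    have "sum_list ms < sum_list ns"
      using k member_le_sum_list[OF nth_mem[OF k(1)]] by (simp add: ms_def sum_list_update)
    then have "sun_over (pendant_cycle (replicate (length ns) 0)) (pendant_cycle ms)"
      using less.hyps[of ms] less.prems ms(1) by simp
    then have "sun_over (pendant_cycle (replicate (length ns) 0))
        (attach_path (k, 0) [(k, Suc (ms ! k))] (pendant_cycle ms))"
      by (rule sun_over.attach) (use k(1) ms(1) in \<open>auto simp: pverts_pendant_cycle\<close>)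
    then show ?thesis
      using attach_pendant_vertex[of k ms] k(1) ms(1) unfolding ms(3)[symmetric] by simp
  qed
qed

lemma unicyclic_pendant_cycle:
  assumes "3 \<le> length ns"
  shows "unicyclic (pendant_cycle ns)"
  unfolding unicyclic_def
  using assms pair_graph_pendant_cycle connected_pendant_cycle cycle_in_pendant_cycle
    cycle_in_pendant_cycle_unique by (auto intro!: ex1I)

text \<open>Serves to tell the counterexamples apart up to isomorphism, by their orders.\<close>

lemma digraph_iso_card_verts:
  assumes "digraph_iso G H"
  shows "card (verts G) = card (verts H)"
  using assms by (auto simp: digraph_iso_def pre_digraph.digraph_isomorphism_def verts_app_iso card_image)

section \<open>Determinants\<close>

text \<open>Reordering permutes rows and columns by the same permutation, so its sign enters twice
  and cancels. This removes the dependence on the arbitrary enumeration in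
  \<open>adjacency_matrix\<close>.\<close>

lemma det_reindex:
  assumes "distinct vs" "distinct ws" "set vs = set ws"
  shows "det (mat (length vs) (length vs) (\<lambda>(i, j). f (vs ! i) (vs ! j))) =
         det (mat (length ws) (length ws) (\<lambda>(i, j). f (ws ! i) (ws ! j)))"
proof -
  have "mset vs = mset ws"
    using assms by (simp add: set_eq_iff_mset_eq_distinct)
  then obtain p where p: "p permutes {..<length ws}" and pl: "permute_list p ws = vs"
    by (rule mset_eq_permutation)
  define n where "n = length ws"
  have len: "length vs = n"
    using pl by (auto simp: n_def)
  have p': "p permutes {0..<n}"
    using p by (simp add: n_def atLeast0LessThan)
  have nth: "vs ! i = ws ! p i" if "i < n" for i
    using permute_list_nth[OF p] that pl by (auto simp: n_def)
  have p_less: "p i < n" if "i < n" for i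
    using permutes_in_image[OF p', of i] that by auto
  define A where "A = mat n n (\<lambda>(i, j). f (ws ! i) (ws ! j))"
  define B where "B = mat n n (\<lambda>(i, j). A $$ (p i, j))"
  \<comment> \<open>Columns are permuted as rows of the transpose, so that the same row rule serves
    twice.\<close>
  define C where "C = mat n n (\<lambda>(i, j). B\<^sup>T $$ (p i, j))"
  have car: "A \<in> carrier_mat n n" "B \<in> carrier_mat n n" "C \<in> carrier_mat n n"
    by (auto simp: A_def B_def C_def)
  have "mat n n (\<lambda>(i, j). f (vs ! i) (vs ! j)) = C\<^sup>T"
    by (rule eq_matI) (auto simp: C_def B_def A_def nth p_less)
  then have "det (mat n n (\<lambda>(i, j). f (vs ! i) (vs ! j))) = det C"
    using det_transpose[OF car(3)] by simp
  also have "\<dots> = signof p * det (B\<^sup>T)"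
    unfolding C_def by (rule det_permute_rows) (use car p' in auto)
  also have "det (B\<^sup>T) = det B"
    using det_transpose[OF car(2)] by simp
  also have "det B = signof p * det A"
    unfolding B_def by (rule det_permute_rows[OF car(1) p'])
  also have "signof p * (signof p * det A) = det A"
    by (simp add: sign_def)
  finally show ?thesis
    by (simp add: A_def len n_def)
qed

text \<open>Laplace expansion along the first row, in a form that rewriting can execute on explicit
  lists. The test for zero entries discards their minors before these are expanded.\<close>

lemma det_mat_of_rows_list_Cons:
  fixes r :: "'a :: comm_ring_1 list"
  assumes "length r = Suc (length rs)" "\<forall>r' \<in> set rs. length r' = Suc (length rs)"
  shows "det (mat_of_rows_list (Suc (length rs)) (r # rs)) =
    (\<Sum>k<Suc (length rs). if r ! k = 0 then 0 else (-1) ^ k * r ! k *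
       det (mat_of_rows_list (length rs) (map (\<lambda>r'. take k r' @ drop (Suc k) r') rs)))"
proof -
  define n where "n = length rs"
  define A where "A = mat_of_rows_list (Suc n) (r # rs)"
  have "det A = (\<Sum>k<Suc n. A $$ (0, k) * cofactor A 0 k)"
    by (rule laplace_expansion_row) (auto simp: A_def mat_of_rows_list_def n_def)
  also have "\<dots> = (\<Sum>k<Suc n. if r ! k = 0 then 0 else (-1) ^ k * r ! k *
       det (mat_of_rows_list n (map (\<lambda>r'. take k r' @ drop (Suc k) r') rs)))"
  proof (rule sum.cong[OF refl])
    fix k assume k: "k \<in> {..<Suc n}"
    have "mat_delete A 0 k = mat_of_rows_list n (map (\<lambda>r'. take k r' @ drop (Suc k) r') rs)"
      using assms(2) k
      by (intro eq_matI) (auto simp: mat_delete_def A_def mat_of_rows_list_def n_def nth_append)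
    then show "A $$ (0, k) * cofactor A 0 k = (if r ! k = 0 then 0 else (-1) ^ k * r ! k *
       det (mat_of_rows_list n (map (\<lambda>r'. take k r' @ drop (Suc k) r') rs)))"
      using k by (simp add: cofactor_def A_def mat_of_rows_list_def)
  qed
  finally show ?thesis by (simp only: A_def n_def)
qed

lemma det_mat_of_rows_list_Nil: "det (mat_of_rows_list 0 []) = 1"
  by (simp add: mat_of_rows_list_def)

text \<open>The factors are those of the reflection fixing vertices 0 and 3: vectors antisymmetric
  under it give the block with rows \<open>d, y\<close> and \<open>y, d\<close>, and symmetric ones
  give a tridiagonal 4 by 4 block, whose determinant is the second factor. The proof is direct
  expansion; the nonzero hypotheses decide the zero tests there.\<close>

lemma det_hexagon:
  fixes y :: "'a :: idom"
  assumes "p \<noteq> 0" "d \<noteq> 0" "q \<noteq> 0" "y \<noteq> 0"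
  shows "det (mat_of_rows_list 6
    [[p, y, 0, 0, 0, y],
     [y, d, y, 0, 0, 0],
     [0, y, d, y, 0, 0],
     [0, 0, y, q, y, 0],
     [0, 0, 0, y, d, y],
     [y, 0, 0, 0, y, d]]) =
    (d\<^sup>2 - y\<^sup>2) * (p * (d * (d * q - 2 * y\<^sup>2) - y\<^sup>2 * q) - 2 * y\<^sup>2 * (d * q - 2 * y\<^sup>2))"
proof -
  \<comment> \<open>The size is a variable of its own, so that the rule also matches numerals such
    as 6.\<close>
  have e: "det (mat_of_rows_list m (r # rs)) = (\<Sum>k<Suc (length rs). if r ! k = 0 then 0 else (-1) ^ k * r ! k *
       det (mat_of_rows_list (length rs) (map (\<lambda>r'. take k r' @ drop (Suc k) r') rs)))"
    if "m = Suc (length rs)" "length r = Suc (length rs)" "\<forall>r' \<in> set rs. length r' = Suc (length rs)"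
    for m and r :: "'a list" and rs
    using det_mat_of_rows_list_Cons[of r rs] that by simp
  show ?thesis
    by (simp add: e det_mat_of_rows_list_Nil assms) (simp add: algebra_simps power2_eq_square)
qed

section \<open>The characteristic polynomial\<close>

text \<open>Allows any convenient enumeration \<open>ws\<close> of the vertices. The diagonal is
  expressed by equality of vertices rather than of indices, so that each entry depends on the two
  vertices only, as \<open>det_reindex\<close> requires.\<close>

lemma char_poly_adjacency_matrix:
  assumes "distinct ws" "set ws = pverts G"
  shows "char_poly (adjacency_matrix G) =
    det (mat (length ws) (length ws) (\<lambda>(i, j).
      (if ws ! i = ws ! j then [:0, 1:] else 0) - (if (ws ! i, ws ! j) \<in> parcs G then 1 else 0)))"
proof -
  define vs where "vs = (SOME vs. distinct vs \<and> set vs = pverts G)"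
  have vs: "distinct vs \<and> set vs = pverts G"
    unfolding vs_def by (rule someI) (use assms in blast)
  have "char_poly (adjacency_matrix G) = det (mat (length vs) (length vs) (\<lambda>(i, j).
      (if vs ! i = vs ! j then [:0, 1:] else 0) - (if (vs ! i, vs ! j) \<in> parcs G then 1 else 0)))"
    unfolding char_poly_def char_poly_matrix_def adjacency_matrix_def vs_def[symmetric] Let_def
    using vs by (intro arg_cong[where f = det] eq_matI) (auto simp: nth_eq_iff_index_eq one_pCons)
  also have "\<dots> = det (mat (length ws) (length ws) (\<lambda>(i, j).
      (if ws ! i = ws ! j then [:0, 1:] else 0) - (if (ws ! i, ws ! j) \<in> parcs G then 1 else 0)))"
    by (rule det_reindex[where f = "\<lambda>u v. (if u = v then [:0, 1:] else 0) -
          (if (u, v) \<in> parcs G then 1 else 0)"]) (use vs assms in auto)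
  finally show ?thesis .
qed

text \<open>The Schur complement without division: here \<open>x\<close> will be the indeterminate,
  which has no inverse in the polynomial ring, so powers of \<open>x\<close> stay on both
  sides.\<close>

lemma det_bordered:
  fixes K :: "'a :: idom mat"
  assumes K: "K \<in> carrier_mat b b" and B: "B \<in> carrier_mat b p"
  shows "det (four_block_mat K (- B) (- B\<^sup>T) (x \<cdot>\<^sub>m 1\<^sub>m p)) * x ^ b = det (x \<cdot>\<^sub>m K - B * B\<^sup>T) * x ^ p"
proof -
  define M where "M = four_block_mat K (- B) (- B\<^sup>T) (x \<cdot>\<^sub>m 1\<^sub>m p)"
  \<comment> \<open>Multiplying by \<open>N\<close> on the right clears the lower left block of
    \<open>M\<close>, and \<open>N\<close> is block triangular with determinant
    \<open>x ^ b\<close>.\<close>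
  define N where "N = four_block_mat (x \<cdot>\<^sub>m 1\<^sub>m b) (0\<^sub>m b p) (B\<^sup>T) (1\<^sub>m p)"
  have car: "M \<in> carrier_mat (b + p) (b + p)" "N \<in> carrier_mat (b + p) (b + p)"
    using K B by (auto simp: M_def N_def)
  have "M * N = four_block_mat (K * (x \<cdot>\<^sub>m 1\<^sub>m b) + - B * B\<^sup>T) (K * 0\<^sub>m b p + - B * 1\<^sub>m p)
      (- B\<^sup>T * (x \<cdot>\<^sub>m 1\<^sub>m b) + (x \<cdot>\<^sub>m 1\<^sub>m p) * B\<^sup>T) (- B\<^sup>T * 0\<^sub>m b p + (x \<cdot>\<^sub>m 1\<^sub>m p) * 1\<^sub>m p)"
    unfolding M_def N_def by (rule mult_four_block_mat) (use K B in auto)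
  also have "\<dots> = four_block_mat (x \<cdot>\<^sub>m K - B * B\<^sup>T) (- B) (0\<^sub>m p b) (x \<cdot>\<^sub>m 1\<^sub>m p)"
  proof (rule cong_four_block_mat)
    show "K * (x \<cdot>\<^sub>m 1\<^sub>m b) + - B * B\<^sup>T = x \<cdot>\<^sub>m K - B * B\<^sup>T"
      using K B by (auto simp: mult_smult_distrib[OF K, of _ b] minus_add_uminus_mat[of _ b b])
    show "K * 0\<^sub>m b p + - B * 1\<^sub>m p = - B"
      using K B by auto
    show "- B\<^sup>T * (x \<cdot>\<^sub>m 1\<^sub>m b) + (x \<cdot>\<^sub>m 1\<^sub>m p) * B\<^sup>T = 0\<^sub>m p b"
      using B by (auto simp: mult_smult_distrib[of _ p b _ b] mult_smult_assoc_mat[of _ p p _ b])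
    show "- B\<^sup>T * 0\<^sub>m b p + (x \<cdot>\<^sub>m 1\<^sub>m p) * 1\<^sub>m p = x \<cdot>\<^sub>m 1\<^sub>m p"
      using B by auto
  qed
  finally have "det M * det N = det (four_block_mat (x \<cdot>\<^sub>m K - B * B\<^sup>T) (- B) (0\<^sub>m p b) (x \<cdot>\<^sub>m 1\<^sub>m p))"
    using det_mult[OF car] by simp
  also have "\<dots> = det (x \<cdot>\<^sub>m K - B * B\<^sup>T) * x ^ p"
    using K B by (subst det_four_block_mat_lower_left_zero[of _ b _ p]) (auto simp: det_smult)
  also have "det N = x ^ b"
    unfolding N_def using B
    by (subst det_four_block_mat_upper_right_zero[of _ b _ p]) auto
  finally show ?thesis
    by (simp add: M_def)
qed

text \<open>With the cycle vertices first, the matrix has the form of \<open>det_bordered\<close>: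
  \<open>K\<close> is the characteristic matrix of the bare cycle, and \<open>B\<close> records
  which cycle vertex each pendant vertex hangs on. The product of \<open>B\<close> with its
  transpose is the diagonal matrix of the pendant counts.\<close>

lemma char_poly_pendant_cycle:
  assumes "3 \<le> length ns"
  defines "b \<equiv> length ns"
  shows "char_poly (adjacency_matrix (pendant_cycle ns)) * [:0, 1:] ^ b =
    det (mat b b (\<lambda>(i, j). if i = j then [:0, 1:]\<^sup>2 - of_nat (ns ! i)
      else if j = Suc i mod b \<or> i = Suc j mod b then - [:0, 1:] else 0)) * [:0, 1:] ^ sum_list ns"
proof -
  have b3: "3 \<le> b" using assms(1) by (simp add: b_def)
  define cs where "cs = map (\<lambda>k. (k, 0 :: nat)) [0..<b]"
  define P where "P = Sigma {..<b} (\<lambda>k. {1..ns ! k})"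
  obtain ps where ps: "set ps = P" "distinct ps"
    using finite_distinct_list[of P] by (auto simp: P_def)
  define p where "p = length ps"
  have len_ps: "p = sum_list ns"
    using distinct_card[OF ps(2)] ps(1)
    by (simp add: P_def p_def sum_list_sum_nth b_def atLeast0LessThan)
  have len_cs: "length cs = b" by (simp add: cs_def)
  have nth_cs: "cs ! i = (i, 0)" if "i < b" for i
    using that by (simp add: cs_def)
  have nth_ps: "fst (ps ! j) < b" "1 \<le> snd (ps ! j)" "snd (ps ! j) \<le> ns ! fst (ps ! j)" if "j < p" for j
    using nth_mem[of j ps] ps(1) that by (auto simp: P_def p_def)
  have inj_ps: "ps ! i = ps ! j \<longleftrightarrow> i = j" if "i < p" "j < p" for i j
    using that ps(2) by (simp add: p_def nth_eq_iff_index_eq)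
  have ws: "distinct (cs @ ps)" "set (cs @ ps) = pverts (pendant_cycle ns)"
  proof -
    show "distinct (cs @ ps)"
      using ps by (auto simp: cs_def distinct_map inj_on_def P_def)
    have "set (cs @ ps) = (\<lambda>k. (k, 0)) ` {..<b} \<union> P"
      using ps by (auto simp: cs_def)
    also have "\<dots> = pverts (pendant_cycle ns)"
      unfolding P_def pverts_pendant_cycle_Sigma b_def by force
    finally show "set (cs @ ps) = pverts (pendant_cycle ns)" .
  qed
  define K where "K = mat b b (\<lambda>(i, j). if i = j then [:0, 1:]
    else if j = Suc i mod b \<or> i = Suc j mod b then -1 else (0 :: complex poly))"
  define B where "B = mat b p (\<lambda>(i, j). if fst (ps ! j) = i then 1 else (0 :: complex poly))"
  have no_loop: "i \<noteq> Suc i mod b" if "i < b" for i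
    using b3 that by (cases "Suc i = b") auto
  have arc: "(u, v) \<in> parcs (pendant_cycle ns) \<longleftrightarrow> fst u < b \<and> fst v < b \<and>
     (snd u = 0 \<and> snd v = 0 \<and> (fst v = Suc (fst u) mod b \<or> fst u = Suc (fst v) mod b) \<or>
      fst u = fst v \<and> (snd u = 0 \<and> 1 \<le> snd v \<and> snd v \<le> ns ! fst u \<or>
        snd v = 0 \<and> 1 \<le> snd u \<and> snd u \<le> ns ! fst u))" for u v
    using parcs_pendant_cycle[of "fst u" "snd u" "fst v" "snd v" ns] by (simp add: b_def)
  have "char_poly (adjacency_matrix (pendant_cycle ns)) =
    det (mat (b + p) (b + p) (\<lambda>(i, j).
      (if (cs @ ps) ! i = (cs @ ps) ! j then [:0, 1:] else 0) -
      (if ((cs @ ps) ! i, (cs @ ps) ! j) \<in> parcs (pendant_cycle ns) then 1 else 0)))"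
    using char_poly_adjacency_matrix[OF ws] by (simp add: len_cs p_def)
  also have "mat (b + p) (b + p) (\<lambda>(i, j).
      (if (cs @ ps) ! i = (cs @ ps) ! j then [:0, 1:] else 0) -
      (if ((cs @ ps) ! i, (cs @ ps) ! j) \<in> parcs (pendant_cycle ns) then 1 else 0)) =
    four_block_mat K (- B) (- B\<^sup>T) ([:0, 1:] \<cdot>\<^sub>m 1\<^sub>m p)" (is "?L = ?R")
  proof (rule eq_matI)
    fix i j assume "i < dim_row ?R" "j < dim_col ?R"
    then have ij: "i < b + p" "j < b + p"
      by (auto simp: K_def)
    note nth = nth_append len_cs
    \<comment> \<open>The four blocks: a pendant vertex is adjacent to a cycle vertex iff their
      first components agree, and two pendant vertices are never adjacent.\<close>
    consider "i < b" "j < b" | "i < b" "b \<le> j" | "b \<le> i" "j < b" | "b \<le> i" "b \<le> j"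
      by linarith
    then show "?L $$ (i, j) = ?R $$ (i, j)"
    proof cases
      case 1
      then show ?thesis
        using ij no_loop by (simp add: nth nth_cs K_def arc)
    next
      case 2
      then have "j - b < p" using ij by linarith
      with 2 nth_ps[OF this] show ?thesis
        using ij by (auto simp: nth nth_cs K_def B_def arc prod_eq_iff)
    next
      case 3
      then have "i - b < p" using ij by linarith
      with 3 nth_ps[OF this] show ?thesis
        using ij by (auto simp: nth nth_cs K_def B_def arc prod_eq_iff)
    next
      case 4
      then have *: "i - b < p" "j - b < p" using ij by linarith+
      with 4 nth_ps[OF *(1)] nth_ps[OF *(2)] show ?thesis
        using ij by (auto simp: nth K_def B_def arc inj_ps)
    qed
  qed (auto simp: K_def)
  also have "det \<dots> * [:0, 1:] ^ b = det ([:0, 1:] \<cdot>\<^sub>m K - B * B\<^sup>T) * [:0, 1:] ^ p"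
    by (rule det_bordered) (auto simp: K_def B_def)
  also have "[:0, 1:] \<cdot>\<^sub>m K - B * B\<^sup>T = mat b b (\<lambda>(i, j). if i = j then [:0, 1:]\<^sup>2 - of_nat (ns ! i)
      else if j = Suc i mod b \<or> i = Suc j mod b then - [:0, 1:] else 0)"
    (is "?L = ?R")
  proof (rule eq_matI)
    fix i l assume "i < dim_row ?R" "l < dim_col ?R"
    then have il: "i < b" "l < b" by auto
    have "(B * B\<^sup>T) $$ (i, l) = (\<Sum>j\<in>{0..<p}. B $$ (i, j) * B $$ (l, j))"
      using il by (auto simp: B_def scalar_prod_def)
    also have "\<dots> = (\<Sum>j\<in>{0..<p}. if fst (ps ! j) = i \<and> fst (ps ! j) = l then 1 else 0)"
      using il by (intro sum.cong) (auto simp: B_def)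
    \<comment> \<open>As \<open>ps\<close> lists \<open>P\<close> without repetition, the entry
      counts the pendant vertices hanging on both \<open>i\<close> and \<open>l\<close>.\<close>
    also have "\<dots> = (\<Sum>q\<in>P. if fst q = i \<and> fst q = l then 1 else 0)"
      using sum.reindex_bij_betw[OF bij_betw_nth[OF ps(2) refl refl]] ps(1)
      by (simp add: p_def atLeast0LessThan)
    also have "\<dots> = of_nat (card {q \<in> P. fst q = i \<and> fst q = l})"
      by (simp add: P_def flip: sum.inter_filter)
    also have "{q \<in> P. fst q = i \<and> fst q = l} = (if i = l then {i} \<times> {1..ns ! i} else {})"
      using il by (auto simp: P_def)
    finally have "(B * B\<^sup>T) $$ (i, l) = (if i = l then of_nat (ns ! i) else 0)"
      by (simp add: card_cartesian_product)
    moreover have "?L $$ (i, l) = [:0, 1:] * K $$ (i, l) - (B * B\<^sup>T) $$ (i, l)"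
      using il by (simp add: K_def B_def)
    ultimately show "?L $$ (i, l) = ?R $$ (i, l)"
      using il by (simp add: K_def power2_eq_square one_pCons)
  qed (auto simp: K_def B_def)
  finally show ?thesis
    by (simp add: len_ps)
qed

section \<open>The hexagon with pendant vertices\<close>

text \<open>The quartic (X^2 - a)^2 - X^2 = (X^2 - X - a)(X^2 + X - a) has the roots M, -M, M + 1,
  -(M + 1) because a = M(M + 1). It occurs once as the antisymmetric factor and once more inside the
  symmetric one, whence the multiplicities 2.\<close>

lemma hexagon_identity:
  fixes X M a K :: "'a :: comm_ring_1"
  assumes a: "a = M * (M + 1)" and K: "K\<^sup>2 = 2 * a + 4"
  shows "((X\<^sup>2 - a)\<^sup>2 - X\<^sup>2) * (X\<^sup>2 * ((X\<^sup>2 - a) * ((X\<^sup>2 - a) * (X\<^sup>2 - 2 * a) - 2 * X\<^sup>2) - X\<^sup>2 * (X\<^sup>2 - 2 * a))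
           - 2 * X\<^sup>2 * ((X\<^sup>2 - a) * (X\<^sup>2 - 2 * a) - 2 * X\<^sup>2)) =
    X\<^sup>2 * ((X - M)\<^sup>2 * (X + M)\<^sup>2 * (X - (M + 1))\<^sup>2 * (X + (M + 1))\<^sup>2 * ((X - K) * (X + K)))"
proof -
  have "(X\<^sup>2 - a)\<^sup>2 - X\<^sup>2 = (X - M) * (X + M) * (X - (M + 1)) * (X + (M + 1))" (is "?D = ?F")
    unfolding a by (simp add: algebra_simps power2_eq_square)
  moreover have "X\<^sup>2 * ((X\<^sup>2 - a) * ((X\<^sup>2 - a) * (X\<^sup>2 - 2 * a) - 2 * X\<^sup>2) - X\<^sup>2 * (X\<^sup>2 - 2 * a))
           - 2 * X\<^sup>2 * ((X\<^sup>2 - a) * (X\<^sup>2 - 2 * a) - 2 * X\<^sup>2) = X\<^sup>2 * ?D * (X\<^sup>2 - (2 * a + 4))"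
    by (simp add: algebra_simps power2_eq_square)
  moreover have "X\<^sup>2 - (2 * a + 4) = (X - K) * (X + K)"
    unfolding K[symmetric] by (simp add: algebra_simps power2_eq_square)
  ultimately show ?thesis
    by (simp only: power2_eq_square mult_ac)
qed

lemma char_poly_S6:
  assumes a: "a = m * (m + 1)" "1 \<le> a" and k: "k\<^sup>2 = 2 * a + 4"
  shows "char_poly (adjacency_matrix (S6 a)) = [:0, 1:] ^ (6 * a - 4) *
    ([:- of_nat m, 1:]\<^sup>2 * [:of_nat m, 1:]\<^sup>2 * [:- of_nat (m + 1), 1:]\<^sup>2 * [:of_nat (m + 1), 1:]\<^sup>2 *
     ([:- of_nat k, 1:] * [:of_nat k, 1:]))"
proof -
  define X :: "complex poly" where "X = [:0, 1:]"
  have X_minus: "X - of_nat c = [:- of_nat c, 1:]" and X_plus: "X + of_nat c = [:of_nat c, 1:]" for c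
    by (simp_all add: X_def of_nat_poly)
  \<comment> \<open>Provides the nonzero diagonal entries that \<open>det_hexagon\<close> asks for;
    its \<open>y\<close> becomes \<open>- X\<close>, whose sign disappears in the squares.\<close>
  have nz: "X\<^sup>2 - of_nat c \<noteq> 0" for c
    by (simp add: X_def of_nat_poly power2_eq_square)
  have X_nz: "X \<noteq> 0"
    by (simp add: X_def)
  define ns where "ns = [0, a, a, 2 * a, a, a]"
  have ns: "length ns = 6" "sum_list ns = 6 * a" "S6 a = pendant_cycle ns" "3 \<le> length ns"
    by (simp_all add: ns_def S6_def)
  define R where "R = mat_of_rows_list 6
      [[X\<^sup>2, - X, 0, 0, 0, - X],
       [- X, X\<^sup>2 - of_nat a, - X, 0, 0, 0],
       [0, - X, X\<^sup>2 - of_nat a, - X, 0, 0],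
       [0, 0, - X, X\<^sup>2 - 2 * of_nat a, - X, 0],
       [0, 0, 0, - X, X\<^sup>2 - of_nat a, - X],
       [- X, 0, 0, 0, - X, X\<^sup>2 - of_nat a]]"
  have R_eq: "mat 6 6 (\<lambda>(i, j). if i = j then X\<^sup>2 - of_nat (ns ! i)
      else if j = Suc i mod 6 \<or> i = Suc j mod 6 then - X else 0) = R" (is "?L = R")
  proof (rule eq_matI)
    fix i j assume "i < dim_row R" "j < dim_col R"
    then have "i \<in> {0, 1, 2, 3, 4, 5}" "j \<in> {0, 1, 2, 3, 4, 5}"
      by (auto simp: R_def mat_of_rows_list_def)
    then show "?L $$ (i, j) = R $$ (i, j)"
      by (auto simp: R_def mat_of_rows_list_def ns_def)
  qed (auto simp: R_def mat_of_rows_list_def)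
  have "det R = ((X\<^sup>2 - of_nat a)\<^sup>2 - (- X)\<^sup>2) *
    (X\<^sup>2 * ((X\<^sup>2 - of_nat a) * ((X\<^sup>2 - of_nat a) * (X\<^sup>2 - 2 * of_nat a) - 2 * (- X)\<^sup>2)
             - (- X)\<^sup>2 * (X\<^sup>2 - 2 * of_nat a))
     - 2 * (- X)\<^sup>2 * ((X\<^sup>2 - of_nat a) * (X\<^sup>2 - 2 * of_nat a) - 2 * (- X)\<^sup>2))"
    unfolding R_def
  proof (rule det_hexagon)
    show "X\<^sup>2 - 2 * of_nat a \<noteq> 0" using nz[of "2 * a"] by simp
  qed (use nz X_nz in simp_all)
  also have "\<dots> = X\<^sup>2 * ((X - of_nat m)\<^sup>2 * (X + of_nat m)\<^sup>2 * (X - (of_nat m + 1))\<^sup>2 * (X + (of_nat m + 1))\<^sup>2 *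
      ((X - of_nat k) * (X + of_nat k)))"
    unfolding power2_minus
  proof (rule hexagon_identity)
    show "of_nat a = of_nat m * (of_nat m + 1 :: complex poly)"
      by (simp add: a(1) algebra_simps)
    show "(of_nat k)\<^sup>2 = (2 * of_nat a + 4 :: complex poly)"
      using arg_cong[OF k, of "of_nat :: nat \<Rightarrow> complex poly"] by simp
  qed
  also have "of_nat m + 1 = (of_nat (m + 1) :: complex poly)"
    by simp
  finally have det_R: "det R = X\<^sup>2 * ([:- of_nat m, 1:]\<^sup>2 * [:of_nat m, 1:]\<^sup>2 *
      [:- of_nat (m + 1), 1:]\<^sup>2 * [:of_nat (m + 1), 1:]\<^sup>2 * ([:- of_nat k, 1:] * [:of_nat k, 1:]))"
    (is "_ = X\<^sup>2 * ?Q")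
    by (simp only: X_minus X_plus)
  have "char_poly (adjacency_matrix (S6 a)) * X ^ 6 = det R * X ^ (6 * a)"
    using char_poly_pendant_cycle[OF ns(4)]
    unfolding X_def[symmetric] ns(1,2) R_eq by (simp only: ns(3))
  also have "\<dots> = ?Q * (X\<^sup>2 * X ^ (6 * a))"
    unfolding det_R by (simp only: ac_simps)
  \<comment> \<open>The exponent of \<open>X\<close> is 2 + 6a - 6; \<open>1 \<le> a\<close> makes
    the subtraction in \<open>6 * a - 4\<close> exact.\<close>
  also have "X\<^sup>2 * X ^ (6 * a) = X ^ (6 * a - 4) * X ^ 6"
    using a(2) by (simp flip: power_add)
  finally have "char_poly (adjacency_matrix (S6 a)) * X ^ 6 = (X ^ (6 * a - 4) * ?Q) * X ^ 6"
    by (simp only: ac_simps)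
  moreover have "X ^ 6 \<noteq> 0"
    using X_nz by simp
  ultimately have "char_poly (adjacency_matrix (S6 a)) = X ^ (6 * a - 4) * ?Q"
    by (simp only: mult_cancel_right simp_thms)
  then show ?thesis
    by (simp only: X_def)
qed

lemma graph_spectrum_S6:
  assumes "a = m * (m + 1)" "1 \<le> a" "k\<^sup>2 = 2 * a + 4"
  shows "graph_spectrum (S6 a) =
    replicate_mset (6 * a - 4) 0 +
    replicate_mset 2 (of_nat m) + replicate_mset 2 (- of_nat m) +
    replicate_mset 2 (of_nat (m + 1)) + replicate_mset 2 (- of_nat (m + 1)) +
    {# of_nat k, - of_nat k #}"
proof -
  have power: "proots ([:c, 1:] ^ n) = replicate_mset n (- c)" for c :: complex and n
    by (simp add: proots_power)
  \<comment> \<open>Root multisets add over products of nonzero polynomials.\<close>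
  have nz: "[:c, 1:] ^ n \<noteq> 0" "[:c, 1:] \<noteq> 0" for c :: complex and n
    by simp_all
  have pair: "{# x, y #} = {# x #} + {# y #}" for x y :: complex
    by simp
  show ?thesis
    unfolding graph_spectrum_def char_poly_S6[OF assms]
    by (simp only: proots_mult power proots_linear_factor nz mult_eq_0_iff simp_thms not_False_eq_True
        minus_minus minus_zero pair add.assoc)
qed

section \<open>Integrality and the failure of divisibility by 4\<close>

lemma integral_graph_iff:
  "integral_graph G \<longleftrightarrow> set_mset (graph_spectrum G) \<subseteq> \<int>"
proof -
  define A where "A = adjacency_matrix G"
  have A: "A \<in> carrier_mat (dim_row A) (dim_row A)"
    by (auto simp: A_def adjacency_matrix_def Let_def)
  \<comment> \<open>Being monic, the polynomial is nonzero, so the elements of its root multiset are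
    exactly the eigenvalues.\<close>
  have "char_poly A \<noteq> 0"
    using degree_monic_char_poly[OF A] by auto
  then show ?thesis
    by (auto simp: integral_graph_def graph_spectrum_def A_def[symmetric] eigenvalue_root_char_poly[OF A])
qed

lemma integral_graph_S6:
  assumes "a = m * (m + 1)" "1 \<le> a" "k\<^sup>2 = 2 * a + 4"
  shows "integral_graph (S6 a)"
  unfolding integral_graph_iff graph_spectrum_S6[OF assms] by (auto split: if_splits)

lemma card_pverts_S6: "card (pverts (S6 a)) = 6 * a + 6"
  by (simp add: S6_def card_pverts_pendant_cycle)

lemma cycle_in_S6_iff: "cycle_in C (S6 a) \<longleftrightarrow> C = pendant_cycle (replicate 6 0)"
proof -
  have len: "length [0, a, a, 2 * a, a, a] = 6" by simp
  show ?thesis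
    using cycle_in_pendant_cycle[of "[0, a, a, 2 * a, a, a]"]
      cycle_in_pendant_cycle_unique[of "[0, a, a, 2 * a, a, a]" C]
    unfolding S6_def len by auto
qed

lemma card_cycle_in_S6: "cycle_in C (S6 a) \<Longrightarrow> card (pverts C) = 6"
  by (simp add: cycle_in_S6_iff card_pverts_pendant_cycle)

lemma generalized_sun_S6: "generalized_sun (S6 a)"
  using sun_over_pendant_cycle[of "[0, a, a, 2 * a, a, a]"] by (auto simp: generalized_sun_def S6_def)

lemma unicyclic_S6: "unicyclic (S6 a)"
  by (simp add: S6_def unicyclic_pendant_cycle)

lemma pair_graph_S6: "pair_graph (S6 a)"
  by (simp add: S6_def pair_graph_pendant_cycle)

text \<open>Otherwise the graph would be a cycle in itself and have 6 vertices, but it has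
  \<open>6 * a + 6\<close>.\<close>

lemma not_is_cycle_graph_S6:
  assumes "1 \<le> a"
  shows "\<not> is_cycle_graph (S6 a)"
proof
  assume "is_cycle_graph (S6 a)"
  moreover have "wf_digraph (with_proj (S6 a))"
    using pair_graph_S6[of a]
    by (simp add: wf_digraph_wp_iff pair_graph_def pair_digraph_def pair_fin_digraph_def)
  ultimately have "cycle_in (S6 a) (S6 a)"
    by (simp add: cycle_in_def subgraph_def compatible_def)
  then show False
    using card_cycle_in_S6 card_pverts_S6[of a] assms by fastforce
qed

lemma not_cycle_order_assertion_S6:
  assumes "1 \<le> a" "integral_graph (S6 a)"
  shows "\<not> cycle_order_assertion (S6 a)"
proof
  assume "cycle_order_assertion (S6 a)"
  moreover obtain C where "cycle_in C (S6 a)"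
    by (simp add: cycle_in_S6_iff)
  ultimately have "4 dvd card (pverts C)" "card (pverts C) = 6"
    using assms generalized_sun_S6 not_is_cycle_graph_S6 card_cycle_in_S6
    by (auto simp: cycle_order_assertion_def)
  then show False by simp
qed

section \<open>The two sequences\<close>

lemma x_k_seq_Suc:
  "x_seq s (Suc j) = 3 * x_seq s j + 4 * k_seq s j"
  "k_seq s (Suc j) = 2 * x_seq s j + 3 * k_seq s j"
  by (simp_all add: x_seq_def k_seq_def xk_step_def split: prod.splits)

text \<open>(3x + 4k)^2 - 2(2x + 3k)^2 = x^2 - 2k^2, since the mixed terms cancel. The value -7 is
  moved across to avoid subtraction of naturals.\<close>

lemma x_k_seq_invariant:
  assumes "s \<in> {(1, 2), (5, 4)}"
  shows "(x_seq s j)\<^sup>2 + 7 = 2 * (k_seq s j)\<^sup>2"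
proof (induction j)
  case 0
  then show ?case using assms by (auto simp: x_seq_def k_seq_def)
next
  case (Suc j)
  then show ?case
    by (simp add: x_k_seq_Suc power2_eq_square algebra_simps)
qed

lemma x_seq_eq:
  assumes "s \<in> {(1, 2), (5, 4)}"
  shows "x_seq s j = 2 * m_seq s j + 1"
proof -
  have "real (x_seq s j) = real (2 * m_seq s j + 1)"
    using m_seq_exact[OF assms, of j] by simp
  then show ?thesis by (simp only: of_nat_eq_iff)
qed

lemma k_seq_squared:
  assumes "s \<in> {(1, 2), (5, 4)}"
  shows "(k_seq s j)\<^sup>2 = 2 * a_seq s j + 4"
  using x_k_seq_invariant[OF assms, of j]
  by (simp add: x_seq_eq[OF assms] a_seq_def power2_eq_square algebra_simps)

lemma strict_mono_a_seq:
  assumes "s \<in> {(1, 2), (5, 4)}"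
  shows "strict_mono (a_seq s)"
proof (rule strict_mono_Suc_iff[THEN iffD2], rule allI)
  fix j
  have "m_seq s j < m_seq s (Suc j)"
    using x_k_seq_Suc(1)[of s j] x_k_seq_invariant[OF assms, of j]
    by (simp add: x_seq_eq[OF assms])
  then show "a_seq s j < a_seq s (Suc j)"
    unfolding a_seq_def by (intro mult_strict_mono) auto
qed

text \<open>Collects the hypotheses of the spectrum lemma. The bound on \<open>m_seq s j\<close>
  excludes the start (1, 2) itself, where \<open>m_seq\<close> is 0 and the graph is the bare
  hexagon.\<close>

lemma a_k_seq:
  assumes "s \<in> {(1, 2), (5, 4)}" "m_seq s j \<ge> 1"
  shows "a_seq s j = m_seq s j * (m_seq s j + 1)" "1 \<le> a_seq s j" "(k_seq s j)\<^sup>2 = 2 * a_seq s j + 4"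
  using assms(2) k_seq_squared[OF assms(1)] by (auto simp: a_seq_def)

text \<open>The family of counterexamples is required to be pairwise non-isomorphic, since
  relabelling the vertices of a single graph would already give infinitely many.\<close>

theorem corollary3p6:
  shows "(\<forall>s \<in> {(1, 2), (5, 4)}. \<forall>j.
            let k = k_seq s j; m = m_seq s j; a = a_seq s j in
            m \<ge> 1 \<longrightarrow>
              generalized_sun (S6 a) \<and>
              integral_graph (S6 a) \<and>
              unicyclic (S6 a) \<and>
              card (pverts (S6 a)) = 6 * a + 6 \<and>
              (\<forall>C. cycle_in C (S6 a) \<longrightarrow> card (pverts C) = 6) \<and>
              graph_spectrum (S6 a) =
                replicate_mset (6 * a - 4) 0 +
                replicate_mset 2 (of_nat m) + replicate_mset 2 (- of_nat m) +
                replicate_mset 2 (of_nat (m + 1)) + replicate_mset 2 (- of_nat (m + 1)) +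
                {# of_nat k, - of_nat k #})
         \<and>
         (\<exists>F :: (nat \<times> nat) pair_pre_digraph set.
            infinite F \<and>
            (\<forall>G \<in> F. \<forall>H \<in> F. G \<noteq> H \<longrightarrow> \<not> digraph_iso (with_proj G) (with_proj H)) \<and>
            (\<forall>G \<in> F. pair_graph G \<and> \<not> cycle_order_assertion G))"
proof (intro conjI)
  show "\<forall>s \<in> {(1, 2), (5, 4)}. \<forall>j.
            let k = k_seq s j; m = m_seq s j; a = a_seq s j in
            m \<ge> 1 \<longrightarrow>
              generalized_sun (S6 a) \<and>
              integral_graph (S6 a) \<and>
              unicyclic (S6 a) \<and>
              card (pverts (S6 a)) = 6 * a + 6 \<and>
              (\<forall>C. cycle_in C (S6 a) \<longrightarrow> card (pverts C) = 6) \<and>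
              graph_spectrum (S6 a) =
                replicate_mset (6 * a - 4) 0 +
                replicate_mset 2 (of_nat m) + replicate_mset 2 (- of_nat m) +
                replicate_mset 2 (of_nat (m + 1)) + replicate_mset 2 (- of_nat (m + 1)) +
                {# of_nat k, - of_nat k #}"
    unfolding Let_def
    by (intro ballI allI impI conjI generalized_sun_S6 unicyclic_S6 card_pverts_S6 card_cycle_in_S6
        integral_graph_S6[OF a_k_seq] graph_spectrum_S6[OF a_k_seq])
next
  \<comment> \<open>From this start already the first term has m = 2 and a = 6, so no index has to
    be skipped.\<close>
  define s :: "nat \<times> nat" where "s = (5, 4)"
  have s: "s \<in> {(1, 2), (5, 4)}" by (simp add: s_def)
  have mono: "strict_mono (a_seq s)"
    by (rule strict_mono_a_seq[OF s])
  have "a_seq s 0 = 6"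
    by (simp add: s_def a_seq_def m_seq_def x_seq_def)
  then have pos: "1 \<le> a_seq s j" for j
    using strict_mono_less_eq[OF mono, of 0 j] by simp
  \<comment> \<open>Distinct orders yield both the infinitude of the family and the absence of
    isomorphisms.\<close>
  have inj: "inj (\<lambda>j. card (pverts (S6 (a_seq s j))))"
    using strict_mono_eq[OF mono] by (auto simp: inj_def card_pverts_S6)
  show "\<exists>F :: (nat \<times> nat) pair_pre_digraph set.
            infinite F \<and>
            (\<forall>G \<in> F. \<forall>H \<in> F. G \<noteq> H \<longrightarrow> \<not> digraph_iso (with_proj G) (with_proj H)) \<and>
            (\<forall>G \<in> F. pair_graph G \<and> \<not> cycle_order_assertion G)"
  proof (intro exI[of _ "range (\<lambda>j. S6 (a_seq s j))"] conjI ballI impI)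
    show "infinite (range (\<lambda>j. S6 (a_seq s j)))"
      using inj by (intro range_inj_infinite) (auto simp: inj_def)
  next
    fix G H assume "G \<in> range (\<lambda>j. S6 (a_seq s j))" "H \<in> range (\<lambda>j. S6 (a_seq s j))" "G \<noteq> H"
    then obtain i j where "G = S6 (a_seq s i)" "H = S6 (a_seq s j)" "i \<noteq> j"
      by blast
    then have "card (pverts G) \<noteq> card (pverts H)"
      using inj_eq[OF inj, of i j] by simp
    then show "\<not> digraph_iso (with_proj G) (with_proj H)"
      using digraph_iso_card_verts[of "with_proj G" "with_proj H"] by auto
  next
    fix G assume "G \<in> range (\<lambda>j. S6 (a_seq s j))"
    then obtain j where G: "G = S6 (a_seq s j)" by auto
    have m: "m_seq s j \<ge> 1"
      using pos[of j] by (cases "m_seq s j") (auto simp: a_seq_def)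
    show "\<not> cycle_order_assertion G"
      unfolding G
      by (rule not_cycle_order_assertion_S6[OF pos integral_graph_S6[OF a_k_seq[OF s m]]])
    show "pair_graph G"
      unfolding G by (rule pair_graph_S6)
  qed
qed

end
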